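(* Let $0<q<\infty$. Consider, for a sequence $\{f_k\}_{k\in\mathbb{Z}}$, the inequality $$\Big(\frac{1}{|P|}\int_P\sum_{k=\mu}^{\infty}\big(\mathfrak{M}_{d/r,2^k}f_k(x)\big)^q\,dx\Big)^{1/q}\lesssim\sup_{R\in\mathcal{D}_\mu}\Big(\frac{1}{|R|}\int_R\sum_{k=\mu}^{\infty}|f_k(x)|^q\,dx\Big)^{1/q},\qquad \mu\in\mathbb{Z},\ P\in\mathcal{D}_\mu,\qquad ( * )$$ where the implicit constant is independent of $\mu$ and $P$. The result that $( * )$ holds for $0<r<q$ (stated in the context) is sharp in the sense that if $r\ge q$ then there exists a sequence $\{f_k\}$, with $f_k\in\mathcal{E}(2^k)$, for which the inequality $( * )$ does not hold.
   Context: Everything is on $\mathbb{R}^d$, and the Fourier transform is $\widehat{f}(\xi)=\int_{\mathbb{R}^d}f(x)e^{-2\pi i\langle x,\xi\rangle}dx$. For $\rho>0$, $\mathcal{E}(\rho)$ is the space of tempered distributions on $\mathbb{R}^d$ whose Fourier transforms are supported in $\{\xi:|\xi|\le 2\rho\}$. $\mathcal{D}_\mu$ is the set of dyadic cubes in $\mathbb{R}^d$ of side length $2^{-\mu}$. For $k\in\mathbb{Z}$ and $\sigma>0$ the Peetre maximal operator is $$\mathfrak{M}_{\sigma,2^k}f(x):=\sup_{y\in\mathbb{R}^d}\frac{|f(x-y)|}{(1+2^k|y|)^\sigma}.$$ The notation $\lesssim$ means that the inequality holds up to an unspecified multiplicative constant. The positive result whose sharpness is asserted is: if $0<r<q<\infty$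 and $f_k\in\mathcal{E}(A2^k)$ for some $A>0$ and all $k\in\mathbb{Z}$, then $( * )$ holds for all $\mu\in\mathbb{Z}$ and $P\in\mathcal{D}_\mu$, with an implicit constant that depends on $A$ and $r$ (and possibly on $d$, $q$) but is independent of $\mu$ and $P$. *)

theory Defs
  imports "HOL-Analysis.Analysis"
begin

section \<open>Smooth and Schwartz functions\<close>

definition partial_deriv :: "'n::finite \<Rightarrow> (real^'n \<Rightarrow> complex) \<Rightarrow> real^'n \<Rightarrow> complex" where
  "partial_deriv i f x = vector_derivative (\<lambda>t. f (x + t *\<^sub>R axis i 1)) (at 0)"

text \<open>The mixed partial derivatives are indexed by words of coordinate directions, so that no
  symmetry of second derivatives is presupposed.\<close>

primrec iter_partial :: "'n::finite list \<Rightarrow> (real^'n \<Rightarrow> complex) \<Rightarrow> real^'n \<Rightarrow> complex" where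
  "iter_partial [] f = f"
| "iter_partial (i # is) f = partial_deriv i (iter_partial is f)"

text \<open>Frechet differentiability of all mixed partial derivatives forces each of them to be
  continuous, so this is the usual class of infinitely differentiable functions.\<close>

definition smooth :: "(real^'n::finite \<Rightarrow> complex) \<Rightarrow> bool" where
  "smooth f \<longleftrightarrow> (\<forall>is x. iter_partial is f differentiable (at x))"

definition schwartz :: "(real^'n::finite \<Rightarrow> complex) set" where
  "schwartz = {f. smooth f \<and>
     (\<forall>(m::nat) is. bounded (range (\<lambda>x. (1 + norm x) ^ m *\<^sub>R iter_partial is f x)))}"

text \<open>Convergence with respect to every Schwartz seminorm.\<close>

definition schwartz_tendsto ::
    "(nat \<Rightarrow> real^'n::finite \<Rightarrow> complex) \<Rightarrow> (real^'n \<Rightarrow> complex) \<Rightarrow> bool" where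
  "schwartz_tendsto \<phi> \<psi> \<longleftrightarrow>
     (\<forall>(m::nat) is. uniform_limit UNIV (\<lambda>j x. (1 + norm x) ^ m *\<^sub>R iter_partial is (\<phi> j) x)
        (\<lambda>x. (1 + norm x) ^ m *\<^sub>R iter_partial is \<psi> x) sequentially)"

definition test_functions :: "(real^'n::finite \<Rightarrow> complex) set" where
  "test_functions = {f. smooth f \<and> compact (closure {x. f x \<noteq> 0})}"


section \<open>Tempered distributions and their Fourier transforms\<close>

text \<open>A distribution is a function on \<^emph>\<open>all\<close> functions of which only the values on
  \<^const>\<open>schwartz\<close> matter. Sequential continuity is continuity, since the Schwartz
  space is metrizable.\<close>

definition tempered_distribution :: "((real^'n::finite \<Rightarrow> complex) \<Rightarrow> complex) \<Rightarrow> bool" where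
  "tempered_distribution u \<longleftrightarrow>
     (\<forall>\<phi>\<in>schwartz. \<forall>\<psi>\<in>schwartz. u (\<lambda>x. \<phi> x + \<psi> x) = u \<phi> + u \<psi>) \<and>
     (\<forall>c. \<forall>\<phi>\<in>schwartz. u (\<lambda>x. c * \<phi> x) = c * u \<phi>) \<and>
     (\<forall>\<phi> \<psi>. (\<forall>j. \<phi> j \<in> schwartz) \<longrightarrow> \<psi> \<in> schwartz \<longrightarrow> schwartz_tendsto \<phi> \<psi> \<longrightarrow>
        (\<lambda>j. u (\<phi> j)) \<longlonglongrightarrow> u \<psi>)"

definition fourier :: "(real^'n::finite \<Rightarrow> complex) \<Rightarrow> real^'n \<Rightarrow> complex" where
  "fourier \<phi> \<xi> = (LINT x|lborel. \<phi> x * exp (- 2 * of_real pi * \<i> * of_real (x \<bullet> \<xi>)))"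

definition fourier_dist ::
    "((real^'n::finite \<Rightarrow> complex) \<Rightarrow> complex) \<Rightarrow> (real^'n \<Rightarrow> complex) \<Rightarrow> complex" where
  "fourier_dist u \<phi> = u (fourier \<phi>)"

definition vanishes_on :: "((real^'n::finite \<Rightarrow> complex) \<Rightarrow> complex) \<Rightarrow> (real^'n) set \<Rightarrow> bool" where
  "vanishes_on u U \<longleftrightarrow> (\<forall>\<phi>\<in>test_functions. closure {x. \<phi> x \<noteq> 0} \<subseteq> U \<longrightarrow> u \<phi> = 0)"

definition dist_support :: "((real^'n::finite \<Rightarrow> complex) \<Rightarrow> complex) \<Rightarrow> (real^'n) set" where
  "dist_support u = - \<Union>{U. open U \<and> vanishes_on u U}"

definition distribution_of ::
    "(real^'n::finite \<Rightarrow> complex) \<Rightarrow> (real^'n \<Rightarrow> complex) \<Rightarrow> complex" where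
  "distribution_of f \<phi> = (LINT x|lborel. f x * \<phi> x)"

text \<open>The space \<open>\<E>(\<rho>)\<close>. By the Paley-Wiener-Schwartz theorem, a tempered distribution with
  compactly supported Fourier transform is given by integration against a smooth function
  of polynomial growth, and this function is its only continuous representative. The
  elements of \<open>\<E>(\<rho>)\<close>, whose pointwise values are used below, are therefore taken to be these
  continuous representatives. The integrability clause rules out the default value
  of the Lebesgue integral.\<close>

definition E_space :: "real \<Rightarrow> (real^'n::finite \<Rightarrow> complex) set" where
  "E_space \<rho> = {f. continuous_on UNIV f \<and>
     (\<forall>\<phi>\<in>schwartz. integrable lborel (\<lambda>x. f x * \<phi> x)) \<and>
     tempered_distribution (distribution_of f) \<and>
     dist_support (fourier_dist (distribution_of f)) \<subseteq> {\<xi>. norm \<xi> \<le> 2 * \<rho>}}"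


section \<open>Dyadic cubes, maximal operator, local means\<close>

definition dyadic_cubes :: "int \<Rightarrow> (real^'n::finite) set set" where
  "dyadic_cubes \<mu> =
     (\<lambda>m :: int^'n. {x. \<forall>i. 2 powi (- \<mu>) * of_int (m $ i) \<le> x $ i \<and>
                              x $ i < 2 powi (- \<mu>) * (of_int (m $ i) + 1)}) ` UNIV"

text \<open>Real powers (with positive exponent) of extended nonnegative reals.\<close>

definition epowr :: "ennreal \<Rightarrow> real \<Rightarrow> ennreal" where
  "epowr x p = (if x = \<infinity> then \<infinity> else ennreal (enn2real x powr p))"

text \<open>The maximal function may be infinite, hence its values are in \<^typ>\<open>ennreal\<close>.\<close>

definition peetre_max :: "real \<Rightarrow> int \<Rightarrow> (real^'n::finite \<Rightarrow> complex) \<Rightarrow> real^'n \<Rightarrow> ennreal" where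
  "peetre_max \<sigma> k f x = (SUP y. ennreal (norm (f (x - y)) / (1 + 2 powi k * norm y) powr \<sigma>))"

text \<open>\<open>((1/|P|) \<integral>\<^sub>P \<Sum>\<^sub>k\<^sub>\<ge>\<^sub>\<mu> F\<^sub>k(x)\<^sup>q dx)\<^sup>1\<^sup>/\<^sup>q\<close>\<close>

definition local_mean ::
    "real \<Rightarrow> int \<Rightarrow> (real^'n::finite) set \<Rightarrow> (int \<Rightarrow> real^'n \<Rightarrow> ennreal) \<Rightarrow> ennreal" where
  "local_mean q \<mu> P F =
     epowr ((\<integral>\<^sup>+x\<in>P. (\<Sum>j. epowr (F (\<mu> + int j) x) q) \<partial>lborel) / emeasure lborel P) (1 / q)"

end

(* A single function suffices: f_0 = g and f_k = 0 otherwise, tested on the cubes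
   P = [0, 2^N)^d, i.e. mu = -N, so that k = 0 is always in the range of summation. Here g is a
   tensor product of m-th powers of sinc with m q >= 2: it has g(0) = 1, it lies in L^1 and in L^q,
   and its Fourier transform is compactly supported. Both sides of the inequality carry the same
   normalization |P|, so the right-hand side is governed by the finite number ||g||_q^q. Taking
   y = x in the Peetre maximal function bounds it below by (1 + |x|)^(-d/r), whose q-th power is at
   least (1 + |x|)^(-d) as q <= r, and the integral of the latter over P grows like N. *)

theory Submission
  imports Defs "HOL-Real_Asymp.Real_Asymp" "HOL-Probability.Sinc_Integral"
    "HOL-Probability.Characteristic_Functions"
begin

section \<open>The Fourier transform of powers of sinc\<close>

text \<open>A majorant with separated variables is integrable by Tonelli, and domination transfers
  this to \<open>h\<close>. Both exchanges of integrals below, for the sinc powers and for the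
  distributional Fourier transform, rest on it.\<close>

lemma integrable_lborel_pair_bound:
  fixes h :: "'a::euclidean_space \<times> 'b::euclidean_space \<Rightarrow> complex"
    and f :: "'a \<Rightarrow> real" and g :: "'b \<Rightarrow> real"
  assumes [measurable]: "h \<in> borel_measurable borel"
    and f: "integrable lborel f" and g: "integrable lborel g"
    and le: "\<And>x y. norm (h (x, y)) \<le> f x * g y"
  shows "integrable (lborel \<Otimes>\<^sub>M lborel) h"
proof -
  have [measurable]: "f \<in> borel_measurable borel" "g \<in> borel_measurable borel"
    using f g by auto
  have "integrable (lborel \<Otimes>\<^sub>M lborel) (\<lambda>z. f (fst z) * g (snd z))"
  proof (rule lborel_pair.Fubini_integrable)
    show "integrable lborel (\<lambda>x. LINT y|lborel. norm (f (fst (x, y)) * g (snd (x, y))))"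
      using f by (simp add: abs_mult)
    show "AE x in lborel. integrable lborel (\<lambda>y. f (fst (x, y)) * g (snd (x, y)))"
      using g by simp
  qed measurable
  then show ?thesis
  proof (rule Bochner_Integration.integrable_bound)
    show "AE z in lborel \<Otimes>\<^sub>M lborel. norm (h z) \<le> norm (f (fst z) * g (snd z))"
      using le by (intro AE_I2) (metis abs_ge_self order_trans prod.collapse real_norm_def)
  qed (simp add: lborel_prod)
qed

lemma sinc_eq_integral_iexp:
  "complex_of_real (sinc x) = 1/2 * (LINT t|lborel. indicator {-1..1} t *\<^sub>R iexp (t * x))"
proof -
  \<comment> \<open>An antiderivative in \<open>t\<close> of the integrand. At \<open>x = 0\<close>
    the quotient would be a division by zero, whereas the integrand is then constantly 1.\<close>
  define F where "F t = (if x = 0 then complex_of_real t else iexp (t * x) / (\<i> * x))" for t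
  have "(LINT t|lborel. indicator {-1..1} t *\<^sub>R iexp (t * x)) = F 1 - F (-1)"
  proof (rule integral_FTC_Icc)
    fix t :: real
    show "(F has_vector_derivative iexp (t * x)) (at t within {-1..1})"
      unfolding F_def
      by (cases "x = 0")
        (auto intro!: derivative_eq_intros has_vector_derivative_real_field
          simp: has_real_derivative_iff_has_vector_derivative mult.commute[of _ \<i>])
  qed (auto intro!: continuous_intros)
  also have "\<dots> = 2 * sinc x"
    by (auto simp: F_def complex_eq_iff Re_divide Im_divide Re_exp Im_exp power2_eq_square field_simps)
  finally show ?thesis by simp
qed

text \<open>Add the bounds \<open>(sinc x)^2 * x^2 <= 1\<close> and \<open>(sinc x)^2 <= 1\<close>.
  The majorant is integrable, and since sinc is bounded by 1 it controls all higher powers as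
  well.\<close>

lemma sinc_square_le: "(sinc x)\<^sup>2 \<le> 2 / (1 + x\<^sup>2)"
proof -
  have a: "(sinc x)\<^sup>2 * x\<^sup>2 \<le> 1"
    by (auto simp: power_divide abs_square_le_1)
  have b: "(sinc x)\<^sup>2 \<le> 1"
  proof (cases "x = 0")
    case False
    then show ?thesis using abs_sin_x_le_abs_x[of x] by (auto simp: abs_square_le_1)
  qed simp
  have "1 + x\<^sup>2 > 0" by (simp add: add_pos_nonneg)
  then show ?thesis using a b by (simp add: pos_le_divide_eq algebra_simps)
qed

lemma abs_sinc_le_1: "\<bar>sinc x\<bar> \<le> 1"
  using abs_sin_x_le_abs_x[of x] by auto

lemma integrable_two_over_1_plus_square: "integrable lborel (\<lambda>x::real. 2 / (1 + x\<^sup>2))"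
proof -
  have "integrable lborel (\<lambda>x::real. inverse (1 + x\<^sup>2))"
    using integrable_inverse_1_plus_square by (simp add: set_integrable_def einterval_def)
  from integrable_mult_right[OF this, of 2] show ?thesis by (simp add: field_simps)
qed

text \<open>The Gaussian factor makes the integral converge absolutely already for \<open>m = 0\<close>, where it is
  explicit. Since \<open>sinc x\<close> is the mean of \<open>exp (\<i> t x)\<close> over \<open>\<bar>t\<bar> \<le> 1\<close>, each further factor
  averages over frequencies at distance at most 1. The bound vanishes as \<open>e \<rightarrow> 0\<close>.\<close>

lemma gaussian_sinc_power_integral_bound:
  fixes e \<delta> s :: real
  assumes e: "e > 0" and \<delta>: "\<delta> \<ge> 0"
  shows "real m + \<delta> \<le> \<bar>s\<bar> \<Longrightarrow>
    norm (LINT x|lborel. complex_of_real (std_normal_density (e * x) * sinc x ^ m) * iexp (s * x))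
      \<le> exp (- (\<delta> / e)\<^sup>2 / 2) / e"
proof (induction m arbitrary: s)
  case 0
  \<comment> \<open>The characteristic function of the standard normal law at \<open>s / e\<close>,
    followed by the substitution \<open>y = e * x\<close>, evaluates the integral without sinc
    factors.\<close>
  have "complex_of_real (exp (- ((s / e)\<^sup>2) / 2))
      = (LINT y|lborel. std_normal_density y *\<^sub>R iexp (s / e * y))"
    using fun_cong[OF char_std_normal_distribution, of "s / e"]
    by (simp add: char_def integral_density)
  also have "\<dots> = e *\<^sub>R (LINT x|lborel. complex_of_real (std_normal_density (e * x)) * iexp (s * x))"
    using e by (subst lborel_integral_real_affine[where c = e and t = 0])
      (auto simp: scaleR_conv_of_real)
  finally have "(LINT x|lborel. complex_of_real (std_normal_density (e * x)) * iexp (s * x))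
      = complex_of_real (exp (- ((s / e)\<^sup>2) / 2) / e)"
    using e by (simp add: scaleR_conv_of_real field_simps)
  moreover have "(\<delta> / e)\<^sup>2 \<le> (s / e)\<^sup>2"
    using 0 e \<delta> by (subst abs_le_square_iff[symmetric]) (simp add: divide_right_mono)
  ultimately show ?case
    using e by (simp del: of_real_divide add: norm_of_real divide_right_mono)
next
  case (Suc m)
  define G where "G x = std_normal_density (e * x)" for x
  have [measurable]: "G \<in> borel_measurable borel" unfolding G_def by measurable
  have G0: "G x \<ge> 0" for x by (simp add: G_def)
  have Gint: "integrable lborel G"
    using e lborel_integrable_real_affine[of std_normal_density e 0] by (simp add: G_def[abs_def])
  define H where "H t x = (indicator {-1..1} t :: real) *\<^sub>R
      (complex_of_real (G x * sinc x ^ m) * iexp ((s + t) * x))" for t x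
  define I where "I t = (LINT x|lborel. complex_of_real (G x * sinc x ^ m) * iexp (t * x))" for t
  define K where "K = exp (- (\<delta> / e)\<^sup>2 / 2) / e"
  \<comment> \<open>The Gaussian gives integrability in \<open>x\<close> and the indicator gives it
    in \<open>t\<close>; of sinc only the bound by 1 enters, so \<open>m\<close> may be any natural
    number.\<close>
  have Hint: "integrable (lborel \<Otimes>\<^sub>M lborel) (\<lambda>(x, t). H t x)"
  proof (rule integrable_lborel_pair_bound[OF _ Gint])
    show "integrable lborel (indicator {-1..1::real} :: real \<Rightarrow> real)" by simp
    show "norm ((\<lambda>(x, t). H t x) (x, t)) \<le> G x * indicator {-1..1} t" for x t
    proof -
      have "\<bar>sinc x\<bar> ^ m \<le> 1" by (intro power_le_one abs_sinc_le_1) auto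
      then have "G x * \<bar>sinc x\<bar> ^ m \<le> G x" using G0 by (simp add: mult_left_le)
      then show ?thesis using G0
        by (auto simp: H_def norm_mult norm_power norm_divide split: split_indicator)
    qed
    show "(\<lambda>(x, t). H t x) \<in> borel_measurable borel"
      unfolding H_def by (subst borel_prod[symmetric]) measurable
  qed
  have "(LINT x|lborel. complex_of_real (G x * sinc x ^ Suc m) * iexp (s * x))
      = (LINT x|lborel. 1/2 * (LINT t|lborel. H t x))"
  proof (rule Bochner_Integration.integral_cong)
    fix x :: real
    have "(LINT t|lborel. H t x)
        = (LINT t|lborel. (complex_of_real (G x * sinc x ^ m) * iexp (s * x)) *
            (indicator {-1..1} t *\<^sub>R iexp (t * x)))"
      by (intro Bochner_Integration.integral_cong)
        (auto simp: H_def ring_distribs exp_add split: split_indicator)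
    also have "\<dots> = complex_of_real (G x * sinc x ^ m) * iexp (s * x)
        * (LINT t|lborel. indicator {-1..1} t *\<^sub>R iexp (t * x))"
      by (rule integral_mult_right_zero)
    finally show "complex_of_real (G x * sinc x ^ Suc m) * iexp (s * x)
        = 1/2 * (LINT t|lborel. H t x)"
      unfolding power_Suc of_real_mult sinc_eq_integral_iexp by (simp add: mult_ac)
  qed simp
  also have "\<dots> = 1/2 * (LINT x|lborel. LINT t|lborel. H t x)"
    by (rule integral_mult_right_zero)
  also have "(LINT x|lborel. LINT t|lborel. H t x) = (LINT t|lborel. LINT x|lborel. H t x)"
    using lborel_pair.Fubini_integral[of "\<lambda>x t. H t x"] Hint by simp
  also have "\<dots> = (LINT t|lborel. indicator {-1..1} t *\<^sub>R I (s + t))"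
    unfolding H_def I_def by simp
  finally have eq: "(LINT x|lborel. complex_of_real (G x * sinc x ^ Suc m) * iexp (s * x))
      = 1/2 * (LINT t|lborel. indicator {-1..1} t *\<^sub>R I (s + t))" .
  have "norm (LINT t|lborel. indicator {-1..1} t *\<^sub>R I (s + t))
      \<le> (LINT t|lborel. norm (indicator {-1..1} t *\<^sub>R I (s + t)))"
    by (rule integral_norm_bound)
  also have "\<dots> \<le> (LINT t::real|lborel. indicator {-1..1} t * K)"
  proof (rule Bochner_Integration.integral_mono')
    show "integrable lborel (\<lambda>t::real. indicator {-1..1} t * K)" by simp
    fix t :: real
    \<comment> \<open>Since \<open>m + 1 + \<delta> \<le> |s|\<close> and
      \<open>|t| \<le> 1\<close>, the shifted frequency still satisfies
      \<open>m + \<delta> \<le> |s + t|\<close>. The length 2 of the interval then cancels the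
      factor 1/2 of the mean.\<close>
    have "norm (I (s + t)) \<le> K" if "t \<in> {-1..1}"
      unfolding I_def K_def G_def using Suc.prems that by (intro Suc.IH) auto
    then show "norm (indicator {-1..1} t *\<^sub>R I (s + t)) \<le> indicator {-1..1} t * K"
      by (auto split: split_indicator)
    show "0 \<le> indicator {-1..1} t * K" using e by (auto simp: K_def)
  qed
  also have "\<dots> = 2 * K" by simp
  finally have "norm (LINT x|lborel. complex_of_real (G x * sinc x ^ Suc m) * iexp (s * x)) \<le> K"
    unfolding eq by (simp add: norm_mult)
  then show ?case by (simp only: G_def K_def)
qed

lemma integrable_sinc_power:
  assumes "m \<ge> 2"
  shows "integrable lborel (\<lambda>x. sinc x ^ m)"
proof (rule Bochner_Integration.integrable_bound[OF integrable_two_over_1_plus_square])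
  show "AE x in lborel. norm (sinc x ^ m) \<le> norm (2 / (1 + x\<^sup>2))"
  proof (intro AE_I2)
    fix x :: real
    have "\<bar>sinc x\<bar> ^ m \<le> \<bar>sinc x\<bar> ^ 2"
      using assms by (intro power_decreasing abs_sinc_le_1) auto
    also have "\<dots> \<le> 2 / (1 + x\<^sup>2)" using sinc_square_le[of x] by simp
    finally show "norm (sinc x ^ m) \<le> norm (2 / (1 + x\<^sup>2))"
      by (simp only: real_norm_def power_abs)
  qed
qed measurable

text \<open>Insert a Gaussian of scale \<open>e = 1 / (n + 1)\<close>. The previous bound sends the
  integrals to 0, as the gap \<open>\<delta>\<close> is positive, while dominated convergence sends
  them to the wanted integral times the normal density at 0. Here \<open>m >= 2\<close> makes the
  sinc power an integrable majorant.\<close>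

lemma fourier_sinc_power_eq_0:
  assumes m: "m \<ge> 2" and s: "\<bar>s\<bar> > real m"
  shows "(LINT x|lborel. complex_of_real (sinc x ^ m) * iexp (s * x)) = 0"
proof -
  define \<delta> where "\<delta> = \<bar>s\<bar> - real m"
  have \<delta>: "\<delta> > 0" using s by (simp add: \<delta>_def)
  define F where "F n = (LINT x|lborel.
      complex_of_real (std_normal_density (1 / real (Suc n) * x) * sinc x ^ m) * iexp (s * x))" for n
  have "norm (F n) \<le> exp (- (\<delta> / (1 / real (Suc n)))\<^sup>2 / 2) / (1 / real (Suc n))" for n
    unfolding F_def using \<delta>
    by (intro gaussian_sinc_power_integral_bound) (auto simp: \<delta>_def)
  then have bd: "norm (F n) \<le> exp (- (\<delta> * real (Suc n))\<^sup>2 / 2) * real (Suc n)" for n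
    by simp
  have "(\<lambda>n. exp (- (\<delta> * real (Suc n))\<^sup>2 / 2) * real (Suc n)) \<longlonglongrightarrow> 0"
    using \<delta> by real_asymp
  then have F0: "F \<longlonglongrightarrow> 0"
    by (rule Lim_null_comparison[OF always_eventually[OF allI[OF bd]]])
  have "F \<longlonglongrightarrow> (LINT x|lborel. complex_of_real (1 / sqrt (2 * pi) * sinc x ^ m) * iexp (s * x))"
    unfolding F_def
  proof (rule integral_dominated_convergence)
    show "integrable lborel (\<lambda>x. \<bar>sinc x ^ m\<bar>)"
      using integrable_sinc_power[OF m] by (rule integrable_abs)
    show "AE x in lborel. (\<lambda>n. complex_of_real (std_normal_density (1 / real (Suc n) * x) * sinc x ^ m)
        * iexp (s * x)) \<longlonglongrightarrow> complex_of_real (1 / sqrt (2 * pi) * sinc x ^ m) * iexp (s * x)"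
    proof (intro AE_I2 tendsto_mult tendsto_const tendsto_of_real)
      fix x :: real
      have "(\<lambda>n. 1 / real (Suc n) * x) \<longlonglongrightarrow> 0" by real_asymp
      then have "(\<lambda>n. std_normal_density (1 / real (Suc n) * x)) \<longlonglongrightarrow> std_normal_density 0"
        unfolding std_normal_density_def by (intro tendsto_intros) auto
      then show "(\<lambda>n. std_normal_density (1 / real (Suc n) * x)) \<longlonglongrightarrow> 1 / sqrt (2 * pi)"
        by (simp add: std_normal_density_def)
    qed
    show "AE x in lborel. norm (complex_of_real (std_normal_density (1 / real (Suc n) * x) * sinc x ^ m)
        * iexp (s * x)) \<le> \<bar>sinc x ^ m\<bar>" for n
    proof (intro AE_I2)
      fix x :: real
      \<comment> \<open>This makes the normal density at most 1, so the sinc power alone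
        dominates.\<close>
      have "1 \<le> sqrt (2 * pi)" using pi_gt3 by simp
      then have "std_normal_density y \<le> 1 * 1" for y
        unfolding std_normal_density_def by (intro mult_mono) auto
      then have "\<bar>std_normal_density (1 / real (Suc n) * x)\<bar> * \<bar>sinc x ^ m\<bar> \<le> 1 * \<bar>sinc x ^ m\<bar>"
        by (intro mult_right_mono) auto
      then show "norm (complex_of_real (std_normal_density (1 / real (Suc n) * x) * sinc x ^ m)
        * iexp (s * x)) \<le> \<bar>sinc x ^ m\<bar>"
        by (simp only: norm_mult norm_of_real abs_mult norm_exp_i_times mult_1 mult_1_right)
    qed
  qed measurable
  with F0 have "(LINT x|lborel. complex_of_real (1 / sqrt (2 * pi) * sinc x ^ m) * iexp (s * x)) = 0"
    using LIMSEQ_unique by blast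
  then have "complex_of_real (1 / sqrt (2 * pi)) *
      (LINT x|lborel. complex_of_real (sinc x ^ m) * iexp (s * x)) = 0"
    unfolding of_real_mult mult.assoc by simp
  then show ?thesis by simp
qed

section \<open>Integrals of tensor products\<close>

lemma inj_axis_1: "inj (\<lambda>i::'n::finite. axis i (1::real))"
  by (simp add: inj_on_def axis_eq_axis)

lemma Basis_cart: "(Basis :: (real^'n::finite) set) = range (\<lambda>i. axis i 1)"
  by (auto simp: Basis_vec_def)

text \<open>The product description of \<open>lborel\<close> is indexed by basis vectors, whereas
  tensor products are written over coordinates. The inverse of \<open>axis\<close> recovers the
  coordinate from its basis vector.\<close>

lemma prod_Basis_cart:
  fixes f :: "'n::finite \<Rightarrow> real \<Rightarrow> 'b::comm_monoid_mult" and x :: "real^'n"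
  shows "(\<Prod>b\<in>Basis. f (inv (\<lambda>i. axis i (1::real)) b) (x \<bullet> b)) = (\<Prod>i\<in>UNIV. f i (x $ i))"
  unfolding Basis_cart prod.reindex[OF inj_axis_1] by (simp add: inv_f_f[OF inj_axis_1] inner_axis)

text \<open>\<open>lborel\<close> on \<open>real^'n\<close> is the image of a finite product of
  one-dimensional \<open>lborel\<close> measures, so Fubini for finite products applies once the
  integrand is rewritten over \<open>Basis\<close>.\<close>

lemma
  fixes f :: "'n::finite \<Rightarrow> real \<Rightarrow> 'b::{real_normed_field,banach,second_countable_topology}"
  assumes f: "\<And>i. integrable lborel (f i)"
  shows integrable_prod_cart: "integrable lborel (\<lambda>x::real^'n. \<Prod>i\<in>UNIV. f i (x $ i))"
    and integral_prod_cart: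
      "integral\<^sup>L lborel (\<lambda>x::real^'n. \<Prod>i\<in>UNIV. f i (x $ i)) = (\<Prod>i\<in>UNIV. integral\<^sup>L lborel (f i))"
proof -
  interpret product_sigma_finite "\<lambda>b::real^'n. lborel :: real measure" by standard
  define idx where "idx = inv (\<lambda>i::'n. axis i (1::real))"
  define F where "F x = (\<Prod>b\<in>Basis. f (idx b) (x \<bullet> b))" for x :: "real^'n"
  have F: "F = (\<lambda>x. \<Prod>i\<in>UNIV. f i (x $ i))"
    unfolding F_def idx_def prod_Basis_cart ..
  have [measurable]: "f i \<in> borel_measurable borel" for i using f[of i] by auto
  have [measurable]: "F \<in> borel_measurable borel" unfolding F_def by measurable
  have G: "F (\<Sum>b\<in>Basis. g b *\<^sub>R b) = (\<Prod>b\<in>Basis. f (idx b) (g b))" for g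
    unfolding F_def by (intro prod.cong) auto
  have "integrable (\<Pi>\<^sub>M b\<in>Basis. lborel) (\<lambda>g. \<Prod>b\<in>Basis. f (idx b) (g b))"
    by (intro product_integrable_prod f) auto
  then show "integrable lborel (\<lambda>x::real^'n. \<Prod>i\<in>UNIV. f i (x $ i))"
    unfolding F[symmetric] by (subst lborel_eq) (simp add: integrable_distr_eq G)
  have "integral\<^sup>L lborel F = (\<integral>g. (\<Prod>b\<in>Basis. f (idx b) (g b)) \<partial>(\<Pi>\<^sub>M b\<in>Basis. lborel))"
    by (subst lborel_eq) (simp add: integral_distr G)
  also have "\<dots> = (\<Prod>b\<in>Basis. integral\<^sup>L lborel (f (idx b)))"
    by (intro product_integral_prod f) auto
  also have "\<dots> = (\<Prod>i\<in>UNIV. integral\<^sup>L lborel (f i))"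
    \<comment> \<open>The factors are constants here, so the evaluation point 0 is
      arbitrary.\<close>
    using prod_Basis_cart[of "\<lambda>i _. integral\<^sup>L lborel (f i)" 0] by (simp add: idx_def)
  finally show "integral\<^sup>L lborel (\<lambda>x::real^'n. \<Prod>i\<in>UNIV. f i (x $ i)) = (\<Prod>i\<in>UNIV. integral\<^sup>L lborel (f i))"
    unfolding F .
qed

section \<open>Integrable functions in \<open>\<E>(\<rho>)\<close>\<close>

lemma smooth_imp_continuous: "smooth f \<Longrightarrow> continuous_on UNIV f"
  unfolding smooth_def
  by (metis differentiable_imp_continuous_within continuous_at_imp_continuous_on iter_partial.simps(1))

lemma schwartz_bounded:
  assumes "\<phi> \<in> schwartz"
  obtains K where "\<And>x. norm (\<phi> x) \<le> K"
proof -
  have "bounded (range (\<lambda>x. (1 + norm x) ^ 0 *\<^sub>R iter_partial [] \<phi> x))"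
    using assms unfolding schwartz_def by blast
  then show ?thesis using that by (auto simp: bounded_iff)
qed

lemma schwartz_borel_measurable: "\<phi> \<in> schwartz \<Longrightarrow> \<phi> \<in> borel_measurable borel"
  by (auto simp: schwartz_def intro!: borel_measurable_continuous_onI smooth_imp_continuous)

lemma integrable_mult_schwartz:
  fixes g :: "real^'n::finite \<Rightarrow> complex"
  assumes g: "integrable lborel g" and \<phi>: "\<phi> \<in> schwartz"
  shows "integrable lborel (\<lambda>x. g x * \<phi> x)"
proof -
  obtain K where K: "\<And>x. norm (\<phi> x) \<le> K" using schwartz_bounded[OF \<phi>] by blast
  have [measurable]: "\<phi> \<in> borel_measurable borel" "g \<in> borel_measurable borel"
    using schwartz_borel_measurable[OF \<phi>] g by auto
  show ?thesis
  proof (rule Bochner_Integration.integrable_bound)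
    show "integrable lborel (\<lambda>x. norm (g x) * K)" using g by simp
    show "AE x in lborel. norm (g x * \<phi> x) \<le> norm (norm (g x) * K)"
      by (intro AE_I2) (auto simp: norm_mult intro!: mult_left_mono order_trans[OF K abs_ge_self] simp: abs_mult)
  qed measurable
qed

text \<open>Against an \<open>L^1\<close> function, uniform convergence of the Schwartz functions is
  enough for continuity, and that is the seminorm with weight exponent 0 and no derivatives.\<close>

lemma tempered_distribution_of_integrable:
  fixes g :: "real^'n::finite \<Rightarrow> complex"
  assumes g: "integrable lborel g"
  shows "tempered_distribution (distribution_of g)"
  unfolding tempered_distribution_def
proof (intro conjI ballI allI impI)
  note int = integrable_mult_schwartz[OF g]
  show "distribution_of g (\<lambda>x. \<phi> x + \<psi> x) = distribution_of g \<phi> + distribution_of g \<psi>"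
    if "\<phi> \<in> schwartz" "\<psi> \<in> schwartz" for \<phi> \<psi>
    using int that by (simp add: distribution_of_def distrib_left)
  show "distribution_of g (\<lambda>x. c * \<phi> x) = c * distribution_of g \<phi>" for c \<phi>
    unfolding distribution_of_def by (simp add: mult.left_commute)
  fix \<phi> :: "nat \<Rightarrow> real^'n \<Rightarrow> complex" and \<psi>
  assume \<phi>: "\<forall>j. \<phi> j \<in> schwartz" and \<psi>: "\<psi> \<in> schwartz" and lim: "schwartz_tendsto \<phi> \<psi>"
  define A where "A = (LINT x|lborel. norm (g x))"
  have A0: "A \<ge> 0" by (simp add: A_def)
  have "uniform_limit UNIV (\<lambda>j x. (1 + norm x) ^ 0 *\<^sub>R iter_partial [] (\<phi> j) x)
      (\<lambda>x. (1 + norm x) ^ 0 *\<^sub>R iter_partial [] \<psi> x) sequentially"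
    using lim unfolding schwartz_tendsto_def by blast
  then have ul: "uniform_limit UNIV \<phi> \<psi> sequentially" by simp
  show "(\<lambda>j. distribution_of g (\<phi> j)) \<longlonglongrightarrow> distribution_of g \<psi>"
  proof (rule metric_LIMSEQ_I)
    fix e :: real assume e: "e > 0"
    \<comment> \<open>Dividing by \<open>A + 1\<close> covers the case \<open>A = 0\<close> and
      makes the final estimate strict.\<close>
    have "e / (A + 1) > 0" using e A0 by simp
    then obtain N where N: "\<And>j x. j \<ge> N \<Longrightarrow> dist (\<phi> j x) (\<psi> x) < e / (A + 1)"
      using uniform_limitD[OF ul] unfolding eventually_sequentially by blast
    have "dist (distribution_of g (\<phi> j)) (distribution_of g \<psi>) < e" if "j \<ge> N" for j
    proof -
      have "distribution_of g (\<phi> j) - distribution_of g \<psi> = (LINT x|lborel. g x * (\<phi> j x - \<psi> x))"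
        using int \<phi> \<psi> by (simp add: distribution_of_def right_diff_distrib)
      then have "dist (distribution_of g (\<phi> j)) (distribution_of g \<psi>)
          \<le> (LINT x|lborel. norm (g x * (\<phi> j x - \<psi> x)))"
        by (simp add: dist_norm)
      also have "\<dots> \<le> (LINT x|lborel. norm (g x) * (e / (A + 1)))"
      proof (rule Bochner_Integration.integral_mono')
        show "integrable lborel (\<lambda>x. norm (g x) * (e / (A + 1)))" using g by simp
        show "norm (g x * (\<phi> j x - \<psi> x)) \<le> norm (g x) * (e / (A + 1))" for x
          unfolding norm_mult using N[OF that, of x]
          by (intro mult_left_mono) (auto simp: dist_norm)
        show "0 \<le> norm (g x) * (e / (A + 1))" for x using e A0 by simp
      qed
      also have "\<dots> = A * (e / (A + 1))" unfolding A_def by (rule integral_mult_left_zero)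
      also have "\<dots> < e" using e A0 by (simp add: field_simps)
      finally show ?thesis .
    qed
    then show "\<exists>N. \<forall>j\<ge>N. dist (distribution_of g (\<phi> j)) (distribution_of g \<psi>) < e" by blast
  qed
qed

lemma integrable_test_function:
  fixes \<phi> :: "real^'n::finite \<Rightarrow> complex"
  assumes "\<phi> \<in> test_functions"
  shows "integrable lborel \<phi>"
proof -
  let ?S = "closure {x. \<phi> x \<noteq> 0}"
  have "continuous_on UNIV \<phi>" "compact ?S"
    using assms smooth_imp_continuous by (auto simp: test_functions_def)
  then have "integrable lborel (\<lambda>x. indicator ?S x *\<^sub>R \<phi> x)"
    by (intro borel_integrable_compact) (auto intro: continuous_on_subset)
  moreover have "indicator ?S x *\<^sub>R \<phi> x = \<phi> x" for x
    using closure_subset[of "{x. \<phi> x \<noteq> 0}"] by (auto split: split_indicator)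
  ultimately show ?thesis by simp
qed

text \<open>The multiplication formula: Fubini moves the Fourier transform from
  \<open>\<phi>\<close> to \<open>g\<close>. It identifies the distributional transform of an
  integrable function with its pointwise one.\<close>

lemma fourier_dist_integrable:
  fixes g \<phi> :: "real^'n::finite \<Rightarrow> complex"
  assumes g: "integrable lborel g" and \<phi>: "integrable lborel \<phi>"
  shows "fourier_dist (distribution_of g) \<phi> = (LINT \<xi>|lborel. \<phi> \<xi> * fourier g \<xi>)"
proof -
  have [measurable]: "g \<in> borel_measurable borel" "\<phi> \<in> borel_measurable borel"
    using g \<phi> by auto
  define H where "H x \<xi> = g x * (\<phi> \<xi> * exp (- 2 * of_real pi * \<i> * of_real (\<xi> \<bullet> x)))" for x \<xi>
  have nexp: "norm (exp (- 2 * of_real pi * \<i> * of_real t)) = 1" for t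
    by (simp add: norm_exp_eq_Re)
  have "integrable (lborel \<Otimes>\<^sub>M lborel) (\<lambda>(x, \<xi>). H x \<xi>)"
  proof (rule integrable_lborel_pair_bound)
    show "integrable lborel (\<lambda>x. norm (g x))" "integrable lborel (\<lambda>x. norm (\<phi> x))"
      using g \<phi> by simp_all
    show "norm ((\<lambda>(x, \<xi>). H x \<xi>) (x, \<xi>)) \<le> norm (g x) * norm (\<phi> \<xi>)" for x \<xi>
      by (simp only: H_def case_prod_conv norm_mult nexp)
    show "(\<lambda>(x, \<xi>). H x \<xi>) \<in> borel_measurable borel"
      unfolding H_def by (subst borel_prod[symmetric]) measurable
  qed
  then have "(LINT \<xi>|lborel. LINT x|lborel. H x \<xi>) = (LINT x|lborel. LINT \<xi>|lborel. H x \<xi>)"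
    using lborel_pair.Fubini_integral[of H] by simp
  also have "(LINT x|lborel. LINT \<xi>|lborel. H x \<xi>) = fourier_dist (distribution_of g) \<phi>"
    unfolding H_def fourier_dist_def distribution_of_def fourier_def
    by (intro Bochner_Integration.integral_cong integral_mult_right_zero) simp
  also have "(LINT \<xi>|lborel. LINT x|lborel. H x \<xi>) = (LINT \<xi>|lborel. \<phi> \<xi> * fourier g \<xi>)"
  proof (rule Bochner_Integration.integral_cong)
    fix \<xi>
    have "(LINT x|lborel. H x \<xi>)
        = (LINT x|lborel. \<phi> \<xi> * (g x * exp (- 2 * of_real pi * \<i> * of_real (x \<bullet> \<xi>))))"
      by (simp only: H_def mult.left_commute inner_commute[of \<xi>])
    then show "(LINT x|lborel. H x \<xi>) = \<phi> \<xi> * fourier g \<xi>"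
      unfolding fourier_def by (simp only: integral_mult_right_zero)
  qed simp
  finally show ?thesis by simp
qed

text \<open>By the multiplication formula, pairing with a test function supported in the open set
  \<open>norm \<xi> > 2 * \<rho>\<close> integrates a product that is 0 at each point. That open set
  therefore misses the support.\<close>

lemma E_space_if_fourier_eq_0:
  fixes g :: "real^'n::finite \<Rightarrow> complex"
  assumes "continuous_on UNIV g" and g: "integrable lborel g"
    and 0: "\<And>\<xi>. norm \<xi> > 2 * \<rho> \<Longrightarrow> fourier g \<xi> = 0"
  shows "g \<in> E_space \<rho>"
proof -
  let ?U = "{\<xi> :: real^'n. norm \<xi> > 2 * \<rho>}"
  have "vanishes_on (fourier_dist (distribution_of g)) ?U"
    unfolding vanishes_on_def
  proof (intro ballI impI)
    fix \<phi> :: "real^'n \<Rightarrow> complex"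
    assume \<phi>: "\<phi> \<in> test_functions" and sub: "closure {x. \<phi> x \<noteq> 0} \<subseteq> ?U"
    have "\<phi> \<xi> * fourier g \<xi> = 0" for \<xi>
      using 0[of \<xi>] sub closure_subset[of "{x. \<phi> x \<noteq> 0}"] by auto
    then show "fourier_dist (distribution_of g) \<phi> = 0"
      unfolding fourier_dist_integrable[OF g integrable_test_function[OF \<phi>]]
      by (simp only: integral_zero)
  qed
  moreover have "open ?U" by (intro open_Collect_less continuous_intros)
  ultimately have "dist_support (fourier_dist (distribution_of g)) \<subseteq> - ?U"
    unfolding dist_support_def by blast
  then show ?thesis
    using assms integrable_mult_schwartz tempered_distribution_of_integrable
    unfolding E_space_def by (auto simp: not_less)
qed

section \<open>Products of powers of sinc\<close>

definition sinc_prod :: "nat \<Rightarrow> real \<Rightarrow> real^'n::finite \<Rightarrow> complex" where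
  "sinc_prod m a x = (\<Prod>i\<in>UNIV. complex_of_real (sinc (a * x $ i) ^ m))"

lemma sinc_prod_0 [simp]: "sinc_prod m a 0 = 1"
  by (simp add: sinc_prod_def)

lemma continuous_on_sinc_prod: "continuous_on UNIV (sinc_prod m a)"
  unfolding sinc_prod_def[abs_def]
  by (intro continuous_intros)

lemma integrable_sinc_power_scaled:
  assumes "m \<ge> 2" "a \<noteq> 0"
  shows "integrable lborel (\<lambda>t. complex_of_real (sinc (a * t) ^ m))"
  using lborel_integrable_real_affine[OF integrable_sinc_power[OF assms(1)] assms(2), of 0]
  by (intro integrable_of_real) (simp only: add_0)

lemma integrable_sinc_prod: "m \<ge> 2 \<Longrightarrow> a \<noteq> 0 \<Longrightarrow> integrable lborel (sinc_prod m a)"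
  unfolding sinc_prod_def[abs_def] by (intro integrable_prod_cart integrable_sinc_power_scaled)

text \<open>The transform factors over the coordinates, so one vanishing factor suffices. Rescaling
  by \<open>a\<close> turns the frequency in coordinate \<open>i\<close> into
  \<open>- 2 * pi * \<xi> $ i / a\<close>, whose modulus exceeds \<open>m\<close>.\<close>

lemma fourier_sinc_prod:
  fixes \<xi> :: "real^'n::finite"
  assumes m: "m \<ge> 2" and a: "a > 0" and i: "2 * pi * \<bar>\<xi> $ i\<bar> > real m * a"
  shows "fourier (sinc_prod m a) \<xi> = 0"
proof -
  define f where "f j t = complex_of_real (sinc (a * t) ^ m) * iexp (- 2 * pi * \<xi> $ j * t)" for j t
  have "integrable lborel (f j)" for j
  proof (rule Bochner_Integration.integrable_bound[OF integrable_sinc_power_scaled[OF m, of a]])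
    show "a \<noteq> 0" using a by simp
    show "f j \<in> borel_measurable lborel" unfolding f_def by measurable
    show "AE t in lborel. norm (f j t) \<le> norm (complex_of_real (sinc (a * t) ^ m))"
      by (intro AE_I2) (simp only: f_def norm_mult norm_exp_i_times mult_1_right)
  qed
  note prod = integral_prod_cart[OF this]
  have "fourier (sinc_prod m a) \<xi> = integral\<^sup>L lborel (\<lambda>x::real^'n. \<Prod>j\<in>UNIV. f j (x $ j))"
    unfolding fourier_def
  proof (rule Bochner_Integration.integral_cong)
    fix x :: "real^'n"
    have "- 2 * of_real pi * \<i> * complex_of_real (x \<bullet> \<xi>)
        = (\<Sum>j\<in>UNIV. \<i> * complex_of_real (- 2 * pi * \<xi> $ j * x $ j))"
      by (simp add: inner_vec_def sum_distrib_left mult_ac)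
    then show "sinc_prod m a x * exp (- 2 * of_real pi * \<i> * of_real (x \<bullet> \<xi>)) = (\<Prod>j\<in>UNIV. f j (x $ j))"
      by (simp only: sinc_prod_def f_def prod.distrib exp_sum[OF finite])
  qed simp
  also have "\<dots> = (\<Prod>j\<in>UNIV. integral\<^sup>L lborel (f j))" by (rule prod)
  also have "integral\<^sup>L lborel (f i) = 0"
  proof -
    define s where "s = - 2 * pi * \<xi> $ i / a"
    have "\<bar>s\<bar> > real m" using i a by (simp add: s_def abs_mult field_simps)
    then have "0 = (LINT x|lborel. complex_of_real (sinc x ^ m) * iexp (s * x))"
      using fourier_sinc_power_eq_0[OF m] by simp
    also have "\<dots> = \<bar>a\<bar> *\<^sub>R (LINT t|lborel.
        complex_of_real (sinc (0 + a * t) ^ m) * iexp (s * (0 + a * t)))"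
      using a by (intro lborel_integral_real_affine) simp
    also have "(\<lambda>t. complex_of_real (sinc (0 + a * t) ^ m) * iexp (s * (0 + a * t))) = f i"
    proof
      fix t
      have "s * (0 + a * t) = - 2 * pi * \<xi> $ i * t" using a by (simp add: s_def)
      then show "complex_of_real (sinc (0 + a * t) ^ m) * iexp (s * (0 + a * t)) = f i t"
        by (simp only: f_def add_0)
    qed
    finally show ?thesis using a by simp
  qed
  then have "(\<Prod>j\<in>UNIV. integral\<^sup>L lborel (f j)) = 0" by (metis finite UNIV_I prod_zero)
  finally show ?thesis .
qed

text \<open>Write \<open>d\<close> for the dimension. The l1 bound on the norm shows that a
  frequency of norm above 2 has a coordinate of modulus above \<open>2 / d\<close>. The scale is
  chosen so that \<open>m * a = 1 / d\<close>, and hence the factor of that coordinate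
  vanishes.\<close>

lemma sinc_prod_in_E_space:
  assumes m: "m \<ge> 2"
  shows "(sinc_prod m (1 / (real m * real CARD('n))) :: real^'n::finite \<Rightarrow> complex) \<in> E_space 1"
proof (rule E_space_if_fourier_eq_0)
  define a where "a = 1 / (real m * real CARD('n))"
  have a: "a > 0" using m by (simp add: a_def)
  show "continuous_on UNIV (sinc_prod m a :: real^'n \<Rightarrow> complex)" by (rule continuous_on_sinc_prod)
  show "integrable lborel (sinc_prod m a :: real^'n \<Rightarrow> complex)" using m a by (intro integrable_sinc_prod) auto
  fix \<xi> :: "real^'n" assume "2 * 1 < norm \<xi>"
  also have "norm \<xi> \<le> (\<Sum>i\<in>UNIV. \<bar>\<xi> $ i\<bar>)" by (rule norm_le_l1_cart)
  finally have "\<not> (\<forall>i. \<bar>\<xi> $ i\<bar> \<le> 2 / real CARD('n))"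
    using sum_bounded_above[of UNIV "\<lambda>i. \<bar>\<xi> $ i\<bar>" "2 / real CARD('n)"] by auto
  then obtain i where i: "\<bar>\<xi> $ i\<bar> > 2 / real CARD('n)" by (auto simp: not_le)
  have "real m * a = 1 / real CARD('n)" using m by (simp add: a_def)
  also have "\<dots> \<le> 2 / real CARD('n)" by (simp add: divide_right_mono)
  also have "\<dots> < 1 * \<bar>\<xi> $ i\<bar>" using i by simp
  also have "\<dots> \<le> (2 * pi) * \<bar>\<xi> $ i\<bar>" using pi_gt3 by (intro mult_right_mono) auto
  finally show "fourier (sinc_prod m a) \<xi> = 0"
    by (intro fourier_sinc_prod[OF m a]) auto
qed

text \<open>As sinc is bounded by 1 and \<open>m * q >= 2\<close>, each factor raised to the power
  \<open>q\<close> is at most the square of sinc, hence at most \<open>B\<close>. A tensor product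
  of integrable functions is integrable.\<close>

lemma nn_integral_sinc_prod_powr_finite:
  assumes q: "q > 0" and m: "real m * q \<ge> 2" and a: "a > 0"
  shows "(\<integral>\<^sup>+x. ennreal (norm (sinc_prod m a (x::real^'n::finite)) powr q) \<partial>lborel) < \<infinity>"
proof -
  define B where "B t = 2 / (1 + t\<^sup>2)" for t :: real
  have "integrable lborel (\<lambda>t. B (a * t))"
    using lborel_integrable_real_affine[OF integrable_two_over_1_plus_square, of a 0] a by (simp add: B_def)
  then have int: "integrable lborel (\<lambda>x::real^'n. \<Prod>i\<in>UNIV. B (a * x $ i))"
    by (rule integrable_prod_cart)
  have "(\<bar>sinc t\<bar> ^ m) powr q \<le> B t" for t
  proof (cases "sinc t = 0")
    case True
    \<comment> \<open>At a zero of sinc the power \<open>0 ^ m\<close> must be 0, which fails for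
      \<open>m = 0\<close>.\<close>
    have "m \<noteq> 0" using m by (cases m) auto
    with True show ?thesis by (simp add: B_def zero_power)
  next
    case False
    then have "(\<bar>sinc t\<bar> ^ m) powr q = \<bar>sinc t\<bar> powr (real m * q)"
      by (simp only: powr_realpow[symmetric] powr_powr zero_less_abs_iff not_False_eq_True)
    also have "\<dots> \<le> \<bar>sinc t\<bar> powr 2" using m by (intro powr_mono' abs_sinc_le_1) auto
    also have "\<dots> \<le> B t" using False sinc_square_le[of t] unfolding B_def
      by (simp only: powr_numeral zero_less_abs_iff not_False_eq_True power2_abs)
    finally show ?thesis .
  qed
  note le = this
  have "norm (sinc_prod m a x) powr q \<le> (\<Prod>i\<in>UNIV. B (a * x $ i))" for x :: "real^'n"
  proof -
    have "norm (sinc_prod m a x) powr q = (\<Prod>i\<in>UNIV. (\<bar>sinc (a * x $ i)\<bar> ^ m) powr q)"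
      unfolding sinc_prod_def prod_norm[symmetric] norm_of_real power_abs
      by (rule prod_powr_distrib)
    also have "\<dots> \<le> (\<Prod>i\<in>UNIV. B (a * x $ i))"
      by (rule prod_mono) (intro conjI powr_ge_zero le)
    finally show ?thesis .
  qed
  then have "(\<integral>\<^sup>+x. ennreal (norm (sinc_prod m a (x::real^'n)) powr q) \<partial>lborel)
      \<le> (\<integral>\<^sup>+x. ennreal (\<Prod>i\<in>UNIV. B (a * (x::real^'n) $ i)) \<partial>lborel)"
    by (intro nn_integral_mono ennreal_leI)
  also have "\<dots> < \<infinity>"
  proof -
    have "(\<integral>\<^sup>+x. ennreal (\<Prod>i\<in>UNIV. B (a * (x::real^'n) $ i)) \<partial>lborel)
      = ennreal (integral\<^sup>L lborel (\<lambda>x::real^'n. \<Prod>i\<in>UNIV. B (a * x $ i)))"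
      by (intro nn_integral_eq_integral int AE_I2 prod_nonneg) (simp add: B_def add_nonneg_nonneg)
    then show ?thesis by simp
  qed
  finally show ?thesis .
qed

section \<open>Dyadic cubes and local means\<close>

text \<open>The half-open box lies between the open and the closed box, which have equal
  measure.\<close>

lemma
  fixes l u :: "real^'n::finite"
  assumes lu: "\<And>i. l $ i \<le> u $ i"
  shows half_open_box_measurable: "{x. \<forall>i. l $ i \<le> x $ i \<and> x $ i < u $ i} \<in> sets borel"
    and emeasure_half_open_box:
      "emeasure lborel {x. \<forall>i. l $ i \<le> x $ i \<and> x $ i < u $ i} = ennreal (\<Prod>i\<in>UNIV. u $ i - l $ i)"
proof -
  let ?Q = "{x. \<forall>i. l $ i \<le> x $ i \<and> x $ i < u $ i}"
  show Q: "?Q \<in> sets borel" by measurable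
  have prod: "(\<Prod>b\<in>Basis. (u - l) \<bullet> b) = (\<Prod>i\<in>UNIV. u $ i - l $ i)"
    unfolding Basis_cart prod.reindex[OF inj_axis_1] by (simp add: inner_axis)
  have le: "l \<bullet> b \<le> u \<bullet> b" if "b \<in> Basis" for b
    using that lu by (auto simp: Basis_cart inner_axis)
  have "emeasure lborel (box l u) \<le> emeasure lborel ?Q"
    using Q by (intro emeasure_mono) (auto simp: mem_box_cart intro: less_imp_le)
  moreover have "emeasure lborel ?Q \<le> emeasure lborel (cbox l u)"
    by (intro emeasure_mono) (auto simp: mem_box_cart less_imp_le)
  ultimately show "emeasure lborel ?Q = ennreal (\<Prod>i\<in>UNIV. u $ i - l $ i)"
    using le by (simp add: prod)
qed

lemma
  assumes "P \<in> (dyadic_cubes \<mu> :: (real^'n::finite) set set)"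
  shows dyadic_cube_measurable: "P \<in> sets borel"
    and emeasure_dyadic_cube: "emeasure lborel P = ennreal ((2 powi (- \<mu>)) ^ CARD('n))"
proof -
  obtain m :: "int^'n" where P: "P = {x. \<forall>i. 2 powi (- \<mu>) * of_int (m $ i) \<le> x $ i \<and>
      x $ i < 2 powi (- \<mu>) * (of_int (m $ i) + 1)}"
    using assms by (auto simp: dyadic_cubes_def)
  define l :: "real^'n" where "l = (\<chi> i. 2 powi (- \<mu>) * of_int (m $ i))"
  define u :: "real^'n" where "u = (\<chi> i. 2 powi (- \<mu>) * (of_int (m $ i) + 1))"
  have P': "P = {x. \<forall>i. l $ i \<le> x $ i \<and> x $ i < u $ i}" by (simp add: P l_def u_def)
  have lu: "l $ i \<le> u $ i" for i
    by (simp add: l_def u_def mult_left_mono)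
  show "P \<in> sets borel" unfolding P' by (rule half_open_box_measurable[OF lu])
  have "u $ i - l $ i = 2 powi (- \<mu>)" for i by (simp add: l_def u_def algebra_simps)
  then show "emeasure lborel P = ennreal ((2 powi (- \<mu>)) ^ CARD('n))"
    unfolding P' emeasure_half_open_box[OF lu] by simp
qed

section \<open>Logarithmic divergence of the critical weight on growing cubes\<close>

definition corner_cube :: "nat \<Rightarrow> (real^'n::finite) set" where
  "corner_cube N = {x. \<forall>i. 0 \<le> x $ i \<and> x $ i < 2 ^ N}"

lemma corner_cube_dyadic: "corner_cube N \<in> dyadic_cubes (- int N)"
  unfolding dyadic_cubes_def corner_cube_def by (rule image_eqI[of _ _ 0]) auto

lemma corner_cube_measurable [measurable]: "corner_cube N \<in> sets borel"
  by (rule dyadic_cube_measurable[OF corner_cube_dyadic])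

lemma emeasure_corner_cube:
  "emeasure lborel (corner_cube N :: (real^'n::finite) set) = ennreal ((2 ^ N) ^ CARD('n))"
  using emeasure_dyadic_cube[OF corner_cube_dyadic, where 'n = 'n] by simp

text \<open>Each of the \<open>N\<close> dyadic shells contributes at least a fixed amount, because the weight is
  comparable to the inverse of the volume of the shell.\<close>

lemma nn_integral_corner_cube_ge:
  "ennreal (real N * (1 / (2 * (1 + real CARD('n)) ^ CARD('n))))
    \<le> (\<integral>\<^sup>+x\<in>(corner_cube N :: (real^'n::finite) set). ennreal ((1 + norm x) powr - real CARD('n)) \<partial>lborel)"
proof (induction N)
  case 0
  then show ?case by simp
next
  case (Suc N)
  define d where "d = CARD('n)"
  have d: "d \<ge> 1" by (simp add: d_def Suc_leI)
  define c where "c = 1 / (2 * (1 + real d) ^ d)"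
  have c: "c > 0" by (simp add: c_def)
  define w where "w x = ennreal ((1 + norm x) powr - real d)" for x :: "real^'n"
  have [measurable]: "w \<in> borel_measurable borel" unfolding w_def by measurable
  define S :: "(real^'n) set" where "S = corner_cube (Suc N) - corner_cube N"
  have [measurable]: "S \<in> sets borel" unfolding S_def by measurable
  have sub: "(corner_cube N :: (real^'n) set) \<subseteq> corner_cube (Suc N)"
    by (auto simp: corner_cube_def intro: less_le_trans)
  define b :: real where "b = (2 ^ Suc N) ^ d"
  have b: "b > 0" by (simp add: b_def)
  have "emeasure lborel S = ennreal b - ennreal ((2 ^ N) ^ d)"
    unfolding S_def b_def d_def using sub
    by (subst emeasure_Diff) (auto simp: emeasure_corner_cube)
  also have "\<dots> = ennreal (b - (2 ^ N) ^ d)" by (simp add: ennreal_minus)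
  also have "\<dots> \<ge> ennreal (b / 2)"
  proof (rule ennreal_leI)
    \<comment> \<open>Doubling the side multiplies the volume by \<open>2 ^ d >= 2\<close>, so the
      smaller cube fills at most half of the larger one.\<close>
    have "2 * (2 ^ N) ^ d \<le> (2::real) ^ d * (2 ^ N) ^ d"
      using d power_increasing[of 1 d "2::real"] by (intro mult_right_mono) auto
    also have "\<dots> = b" by (simp add: b_def power_mult_distrib)
    finally show "b / 2 \<le> b - (2 ^ N) ^ d" by simp
  qed
  finally have mS: "ennreal (b / 2) \<le> emeasure lborel S" .
  \<comment> \<open>All coordinates on the shell are at most \<open>2 ^ Suc N\<close>, so the l1
    bound gives \<open>1 + norm x \<le> (1 + d) * 2 ^ Suc N\<close>, and \<open>b\<close> is the
    \<open>d\<close>-th power of the last factor.\<close>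
  have wS: "ennreal (1 / ((1 + real d) ^ d * b)) \<le> w x" if "x \<in> S" for x
  proof -
    have x: "\<bar>x $ i\<bar> \<le> 2 ^ Suc N" for i
      using that by (auto simp: S_def corner_cube_def intro: less_imp_le)
    have "norm x \<le> (\<Sum>i\<in>UNIV. \<bar>x $ i\<bar>)" by (rule norm_le_l1_cart)
    also have "\<dots> \<le> real d * 2 ^ Suc N"
      using sum_bounded_above[of UNIV "\<lambda>i. \<bar>x $ i\<bar>" "2 ^ Suc N"] x by (simp add: d_def)
    finally have "1 + norm x \<le> (1 + real d) * 2 ^ Suc N"
      using one_le_power[of "2::real" "Suc N"] unfolding distrib_right by linarith
    then have "(1 + norm x) ^ d \<le> (1 + real d) ^ d * b"
      unfolding b_def power_mult_distrib[symmetric] by (intro power_mono) auto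
    moreover have "0 < 1 + norm x" by (simp add: add_pos_nonneg)
    ultimately have "1 / ((1 + real d) ^ d * b) \<le> 1 / (1 + norm x) ^ d"
      by (intro divide_left_mono) (auto intro!: mult_pos_pos b)
    also have "\<dots> = (1 + norm x) powr - real d"
      using \<open>0 < 1 + norm x\<close> by (simp add: powr_minus powr_realpow divide_inverse)
    finally show ?thesis unfolding w_def by (rule ennreal_leI)
  qed
  \<comment> \<open>The volume \<open>b\<close> cancels between the weight and the measure of the
    shell, which makes \<open>c\<close> independent of \<open>N\<close>.\<close>
  have "ennreal c = ennreal (1 / ((1 + real d) ^ d * b)) * ennreal (b / 2)"
    using b by (simp add: c_def ennreal_mult[symmetric])
  also have "\<dots> \<le> ennreal (1 / ((1 + real d) ^ d * b)) * emeasure lborel S"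
    by (intro mult_left_mono mS) auto
  also have "\<dots> = (\<integral>\<^sup>+x\<in>S. ennreal (1 / ((1 + real d) ^ d * b)) \<partial>lborel)"
    by (simp add: nn_integral_cmult_indicator)
  also have "\<dots> \<le> (\<integral>\<^sup>+x\<in>S. w x \<partial>lborel)"
    using wS by (intro nn_integral_mono) (auto split: split_indicator)
  finally have shell: "ennreal c \<le> (\<integral>\<^sup>+x\<in>S. w x \<partial>lborel)" .
  have "ennreal (real (Suc N) * c) = ennreal (real N * c) + ennreal c"
    using c by (simp add: ennreal_plus[symmetric] distrib_right add.commute del: ennreal_plus)
  also have "\<dots> \<le> (\<integral>\<^sup>+x\<in>corner_cube N. w x \<partial>lborel) + (\<integral>\<^sup>+x\<in>S. w x \<partial>lborel)"
    using Suc.IH shell unfolding c_def w_def d_def by (intro add_mono) auto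
  also have "\<dots> = (\<integral>\<^sup>+x\<in>corner_cube N \<union> S. w x \<partial>lborel)"
    by (intro nn_integral_disjoint_pair[symmetric]) (auto simp: S_def)
  also have "corner_cube N \<union> S = corner_cube (Suc N)" using sub by (auto simp: S_def)
  finally show ?case unfolding c_def w_def d_def .
qed

section \<open>Extended powers and sums with a single nonzero term\<close>

lemma epowr_mono: "x \<le> y \<Longrightarrow> 0 \<le> p \<Longrightarrow> epowr x p \<le> epowr y p"
  by (cases x; cases y) (auto simp: epowr_def top_unique intro!: ennreal_leI powr_mono2)

lemma epowr_ennreal: "0 \<le> a \<Longrightarrow> epowr (ennreal a) p = ennreal (a powr p)"
  by (simp add: epowr_def)

lemma epowr_0 [simp]: "epowr 0 p = 0"
  by (simp add: epowr_def)

text \<open>The shifted index \<open>\<mu> + int j\<close> meets 0 exactly when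
  \<open>\<mu> \<le> 0\<close>, and then only at \<open>j = nat (- \<mu>)\<close>.\<close>

lemma suminf_single_index:
  fixes h :: "int \<Rightarrow> ennreal"
  assumes "\<And>k. k \<noteq> 0 \<Longrightarrow> h k = 0"
  shows "(\<Sum>j. h (\<mu> + int j)) = (if \<mu> \<le> 0 then h 0 else 0)"
proof -
  have "(\<Sum>j. h (\<mu> + int j)) = (\<Sum>j\<in>(if \<mu> \<le> 0 then {nat (- \<mu>)} else {}). h (\<mu> + int j))"
    by (intro suminf_finite) (auto intro!: assms split: if_splits)
  then show ?thesis by auto
qed

lemma peetre_max_zero: "peetre_max \<sigma> k (\<lambda>x. 0) x = 0"
  by (simp add: peetre_max_def)

theorem mainTheorem5:
  fixes q r :: real
  assumes "0 < q" and "q \<le> r"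
  shows "\<exists>f :: int \<Rightarrow> real^'n::finite \<Rightarrow> complex.
    (\<forall>k. f k \<in> E_space (2 powi k)) \<and>
    \<not> (\<exists>C::real. 0 < C \<and> (\<forall>\<mu>. \<forall>P\<in>dyadic_cubes \<mu>.
          local_mean q \<mu> P (\<lambda>k. peetre_max (real CARD('n) / r) k (f k))
          \<le> ennreal C * (SUP R\<in>dyadic_cubes \<mu>. local_mean q \<mu> R (\<lambda>k x. ennreal (norm (f k x))))))"
proof -
  define d where "d = real CARD('n)"
  have d: "d > 0" by (simp add: d_def)
  \<comment> \<open>The 2 makes \<open>g\<close> integrable, and \<open>2 / q\<close> gives
    \<open>m * q >= 2\<close>, which puts \<open>g\<close> in \<open>L^q\<close>.\<close>
  define m where "m = max 2 (nat \<lceil>2 / q\<rceil>)"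
  have m: "m \<ge> 2" by (simp add: m_def)
  have "2 / q \<le> real m" unfolding m_def by linarith
  then have mq: "real m * q \<ge> 2" using assms by (simp add: field_simps)
  define g :: "real^'n \<Rightarrow> complex" where "g = sinc_prod m (1 / (real m * real CARD('n)))"
  define f where "f k = (if k = 0 then g else (\<lambda>x. 0))" for k :: int
  have fE: "f k \<in> E_space (2 powi k)" for k
  proof (cases "k = 0")
    case True
    then show ?thesis using sinc_prod_in_E_space[OF m, where 'n = 'n] by (simp add: f_def g_def)
  next
    case False
    have "(\<lambda>x::real^'n. 0::complex) \<in> E_space (2 powi k)"
      by (rule E_space_if_fourier_eq_0) (auto simp: fourier_def)
    with False show ?thesis by (simp add: f_def)
  qed
  have "(\<integral>\<^sup>+x. ennreal (norm (g x) powr q) \<partial>lborel) < \<infinity>"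
    unfolding g_def using assms mq m by (intro nn_integral_sinc_prod_powr_finite) auto
  then obtain K where K: "(\<integral>\<^sup>+x. ennreal (norm (g x) powr q) \<partial>lborel) = ennreal K" "K \<ge> 0"
    by (cases "\<integral>\<^sup>+x. ennreal (norm (g x) powr q) \<partial>lborel") auto
  define c where "c = 1 / (2 * (1 + real CARD('n)) ^ CARD('n))"
  have c: "c > 0" by (simp add: c_def)
  have "\<not> (\<forall>\<mu>. \<forall>P\<in>dyadic_cubes \<mu>. local_mean q \<mu> P (\<lambda>k. peetre_max (real CARD('n) / r) k (f k))
          \<le> ennreal C * (SUP R\<in>dyadic_cubes \<mu>. local_mean q \<mu> R (\<lambda>k x. ennreal (norm (f k x)))))"
    if C: "C > 0" for C
  proof
    assume *: "\<forall>\<mu>. \<forall>P\<in>dyadic_cubes \<mu>. local_mean q \<mu> P (\<lambda>k. peetre_max (real CARD('n) / r) k (f k))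
          \<le> ennreal C * (SUP R\<in>dyadic_cubes \<mu>. local_mean q \<mu> R (\<lambda>k x. ennreal (norm (f k x))))"
    \<comment> \<open>Raised to the power \<open>q\<close> and freed of the common volume, the
      assumed inequality will read \<open>N * c \<le> C powr q * K\<close>; this choice of
      \<open>N\<close> violates it.\<close>
    obtain N :: nat where N: "real N * c > C powr q * K"
      using reals_Archimedean3[OF c] by blast
    define V :: real where "V = (2 ^ N) ^ CARD('n)"
    have V: "V > 0" by (simp add: V_def)
    define M where "M = (SUP R\<in>dyadic_cubes (- int N). local_mean q (- int N) R (\<lambda>k x. ennreal (norm (f k x))))"
    have lower: "ennreal ((real N * c / V) powr (1 / q))
        \<le> local_mean q (- int N) (corner_cube N) (\<lambda>k. peetre_max (real CARD('n) / r) k (f k))"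
    proof -
      have pt: "ennreal ((1 + norm x) powr - d)
          \<le> (\<Sum>j. epowr (peetre_max (real CARD('n) / r) (- int N + int j) (f (- int N + int j)) x) q)" for x
      proof -
        \<comment> \<open>This is where \<open>q \<le> r\<close> enters: the maximal function raised
          to the power \<open>q\<close> decays no faster than the critical weight.\<close>
        have "(d / r) * q \<le> d" using assms d by (simp add: field_simps)
        then have "(1 + norm x) powr - d \<le> (1 + norm x) powr (- ((d / r) * q))"
          by (intro powr_mono) auto
        also have "\<dots> = (1 / (1 + norm x) powr (d / r)) powr q"
          by (simp add: powr_minus powr_divide powr_powr divide_inverse inverse_powr)
        finally have "ennreal ((1 + norm x) powr - d) \<le> epowr (ennreal (1 / (1 + norm x) powr (d / r))) q"
          by (simp add: epowr_ennreal ennreal_leI)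
        also have "\<dots> \<le> epowr (peetre_max (d / r) 0 g x) q"
        proof (intro epowr_mono)
          \<comment> \<open>The competitor \<open>y = x\<close> in the supremum, together with
            \<open>g 0 = 1\<close>.\<close>
          have "ennreal (1 / (1 + norm x) powr (d / r))
              = ennreal (norm (g (x - x)) / (1 + 2 powi 0 * norm x) powr (d / r))"
            by (simp add: g_def)
          also have "\<dots> \<le> peetre_max (d / r) 0 g x"
            unfolding peetre_max_def by (rule SUP_upper) simp
          finally show "ennreal (1 / (1 + norm x) powr (d / r)) \<le> peetre_max (d / r) 0 g x" .
        qed (use assms in simp)
        also have "\<dots> = (\<Sum>j. epowr (peetre_max (real CARD('n) / r) (- int N + int j) (f (- int N + int j)) x) q)"
          using suminf_single_index[of "\<lambda>k. epowr (peetre_max (real CARD('n) / r) k (f k) x) q" "- int N"]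
          by (simp add: f_def peetre_max_zero d_def)
        finally show ?thesis .
      qed
      have "ennreal (real N * c) \<le> (\<integral>\<^sup>+x\<in>corner_cube N. ennreal ((1 + norm (x::real^'n)) powr - d) \<partial>lborel)"
        unfolding c_def d_def by (rule nn_integral_corner_cube_ge)
      also have "\<dots> \<le> (\<integral>\<^sup>+x\<in>corner_cube N. (\<Sum>j. epowr
          (peetre_max (real CARD('n) / r) (- int N + int j) (f (- int N + int j)) x) q) \<partial>lborel)"
        by (intro nn_integral_mono mult_right_mono pt) auto
      finally have "ennreal (real N * c) / ennreal V \<le> (\<integral>\<^sup>+x\<in>corner_cube N. (\<Sum>j. epowr
          (peetre_max (real CARD('n) / r) (- int N + int j) (f (- int N + int j)) x) q) \<partial>lborel) / ennreal V"
        by (rule divide_right_mono_ennreal)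
      moreover have "ennreal (real N * c) / ennreal V = ennreal (real N * c / V)"
        using V c by (simp add: divide_ennreal)
      moreover have "real N * c / V \<ge> 0" using V c by simp
      ultimately show ?thesis
        unfolding local_mean_def emeasure_corner_cube V_def[symmetric]
        using assms by (simp add: epowr_ennreal[symmetric] epowr_mono)
    qed
    have upper: "M \<le> ennreal ((K / V) powr (1 / q))"
      unfolding M_def
    proof (rule SUP_least)
      fix R :: "(real^'n) set" assume R: "R \<in> dyadic_cubes (- int N)"
      have "(\<Sum>j. epowr (ennreal (norm (f (- int N + int j) x))) q) = ennreal (norm (g x) powr q)" for x
      proof -
        have "epowr (ennreal (norm (f k x))) q = 0" if "k \<noteq> 0" for k
          using that by (simp add: f_def)
        from suminf_single_index[of "\<lambda>k. epowr (ennreal (norm (f k x))) q", OF this, of "- int N"]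
        have "(\<Sum>j. epowr (ennreal (norm (f (- int N + int j) x))) q) = epowr (ennreal (norm (f 0 x))) q"
          by simp
        also have "\<dots> = ennreal (norm (g x) powr q)" by (simp add: f_def epowr_ennreal)
        finally show ?thesis .
      qed
      then have "(\<integral>\<^sup>+x\<in>R. (\<Sum>j. epowr (ennreal (norm (f (- int N + int j) x))) q) \<partial>lborel)
          = (\<integral>\<^sup>+x\<in>R. ennreal (norm (g x) powr q) \<partial>lborel)"
        by (simp only:)
      \<comment> \<open>Enlarging \<open>R\<close> to the whole space gives a bound that is the same
        for all cubes of this size.\<close>
      also have "\<dots> \<le> (\<integral>\<^sup>+x. ennreal (norm (g x) powr q) \<partial>lborel)"
        by (intro nn_integral_mono) (auto split: split_indicator)
      finally have "(\<integral>\<^sup>+x\<in>R. (\<Sum>j. epowr (ennreal (norm (f (- int N + int j) x))) q) \<partial>lborel) / ennreal V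
          \<le> ennreal K / ennreal V"
        unfolding K by (rule divide_right_mono_ennreal)
      moreover have "ennreal K / ennreal V = ennreal (K / V)" using V K by (simp add: divide_ennreal)
      moreover have "emeasure lborel R = ennreal V" using emeasure_dyadic_cube[OF R] by (simp add: V_def)
      moreover have "K / V \<ge> 0" using V K by simp
      ultimately show "local_mean q (- int N) R (\<lambda>k x. ennreal (norm (f k x))) \<le> ennreal ((K / V) powr (1 / q))"
        unfolding local_mean_def using assms by (simp add: epowr_ennreal[symmetric] epowr_mono)
    qed
    have "ennreal ((real N * c / V) powr (1 / q)) \<le> ennreal C * M"
      unfolding M_def by (rule order_trans[OF lower *[rule_format, OF corner_cube_dyadic]])
    also have "\<dots> \<le> ennreal C * ennreal ((K / V) powr (1 / q))"
      by (intro mult_left_mono upper) auto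
    also have "\<dots> = ennreal (C * (K / V) powr (1 / q))"
      using C by (simp add: ennreal_mult)
    finally have "(real N * c / V) powr (1 / q) \<le> C * (K / V) powr (1 / q)"
      using C by (subst (asm) ennreal_le_iff) auto
    \<comment> \<open>Taking the power \<open>q\<close> removes the roots on both sides; the
      division by \<open>V\<close> common to both then drops out.\<close>
    then have "((real N * c / V) powr (1 / q)) powr q \<le> (C * (K / V) powr (1 / q)) powr q"
      using assms by (intro powr_mono2) auto
    then have "real N * c / V \<le> C powr q * (K / V)"
      using assms V K c C by (simp add: powr_powr powr_mult)
    then show False using N V by (simp add: field_simps)
  qed
  with fE show ?thesis by blast
qed

end
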